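(* Let $D_n$ be the dihedral group of order $2n$ and let $\langle b\rangle$ be a non-normal subgroup of $D_n$ of order $2$. Then $$\mathrm{ict}(D_n,\langle b\rangle)=\frac{1}{\phi(n)}\sum_{\substack{1\le j\le n\\ (j,n)=1}}2^{\,t_j+k_j-1},$$ where $\phi$ is Euler's phi function.
   Context: A left transversal of a subgroup $H$ in a finite group $G$ is a set consisting of exactly one element from each left coset of $H$ in $G$, the representative of the coset $H$ being the identity. Each left transversal $S$ carries the induced binary operation $\circ$ defined by $\{x\circ y\}=S\cap xyH$; two left transversals are isomorphic if there is a bijection between them preserving the induced operations. $\mathrm{ict}(G,H)$ is the number of isomorphism classes of left transversals of $H$ in $G$. The numbers $t_j,k_j$ are defined as follows. For $j$ coprime to $n$, $j^{-1}$ denotes an inverse of $j$ modulo $n$, $o(j)$ the order of $j$ in the group $U_n$ of units of $\mathbb{Z}_n$, and $(\cdot,\cdot)$ the greatest common divisor. Put $k_1=n$, $t_1=0$. For $1<j\le n$ with $(j,n)=1$, put $k_j=\big|\{m\in\{1,\dots,n\}\mid m=1+ln/(n,j^{-1}-1)\text{ for some integer } l\ge0\}\big|$, and define $t_j$ by $k_j+t_j=\frac{1}{o(j)}\sum_{m=1}^{o(j)}k_{j^m}$, where the index $j^m$ is taken modulo $n$. *)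

theory Defs
  imports "HOL-Algebra.Left_Coset" "HOL-Algebra.Generated_Groups" "HOL-Number_Theory.Number_Theory"
begin

section \<open>Left transversals and their induced operations\<close>

definition left_transversals :: "('a, 'c) monoid_scheme \<Rightarrow> 'a set \<Rightarrow> 'a set set" where
  "left_transversals G H =
     {S. S \<subseteq> carrier G \<and> \<one>\<^bsub>G\<^esub> \<in> S \<and> (\<forall>C \<in> lcosets\<^bsub>G\<^esub> H. \<exists>!x. x \<in> S \<inter> C)}"

text \<open>
  A left transversal with its induced operation, packaged as a record so that the isomorphism
  relation of \<^theory>\<open>HOL-Algebra.Group\<close> applies. The operation is in general not associative.
\<close>

definition transversal_struct ::
    "('a, 'c) monoid_scheme \<Rightarrow> 'a set \<Rightarrow> 'a set \<Rightarrow> 'a monoid" where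
  "transversal_struct G H S =
     \<lparr>carrier = S,
      monoid.mult = (\<lambda>x y. the_elem (S \<inter> ((x \<otimes>\<^bsub>G\<^esub> y) <#\<^bsub>G\<^esub> H))),
      one = \<one>\<^bsub>G\<^esub>\<rparr>"

definition transversal_iso ::
    "('a, 'c) monoid_scheme \<Rightarrow> 'a set \<Rightarrow> ('a set \<times> 'a set) set" where
  "transversal_iso G H =
     {(S, T). S \<in> left_transversals G H \<and> T \<in> left_transversals G H \<and>
              transversal_struct G H S \<cong> transversal_struct G H T}"

definition ict :: "('a, 'c) monoid_scheme \<Rightarrow> 'a set \<Rightarrow> nat" where
  "ict G H = card (left_transversals G H // transversal_iso G H)"


section \<open>The dihedral group of order \<open>2n\<close>\<close>

text \<open>
  The pair \<open>(i, s)\<close> stands for \<open>a\<^sup>i b\<^sup>s\<close>, where \<open>a\<close> is a rotation of order \<open>n\<close>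
  and \<open>b\<close> a reflection.
\<close>

definition dihedral :: "nat \<Rightarrow> (int \<times> bool) monoid" where
  "dihedral n =
     \<lparr>carrier = {0..<int n} \<times> UNIV,
      monoid.mult = (\<lambda>(i, s) (j, t). ((if s then i - j else i + j) mod int n, s \<noteq> t)),
      one = (0, False)\<rparr>"

lemma group_dihedral:
  assumes "n \<ge> 1"
  shows "group (dihedral n)"
proof (rule groupI)
  fix x y z
  assume "x \<in> carrier (dihedral n)" "y \<in> carrier (dihedral n)" "z \<in> carrier (dihedral n)"
  show "x \<otimes>\<^bsub>dihedral n\<^esub> y \<otimes>\<^bsub>dihedral n\<^esub> z =
        x \<otimes>\<^bsub>dihedral n\<^esub> (y \<otimes>\<^bsub>dihedral n\<^esub> z)"
    by (cases x; cases y; cases z) (auto simp: dihedral_def mod_simps algebra_simps)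
next
  fix x assume x: "x \<in> carrier (dihedral n)"
  obtain i s where [simp]: "x = (i, s)" by (cases x)
  show "\<exists>y \<in> carrier (dihedral n). y \<otimes>\<^bsub>dihedral n\<^esub> x = \<one>\<^bsub>dihedral n\<^esub>"
    using assms
    by (intro bexI[of _ "((if s then i else - i) mod int n, s)"])
       (auto simp: dihedral_def mod_simps)
qed (use assms in \<open>auto simp: dihedral_def\<close>)

lemma order_dihedral: "order (dihedral n) = 2 * n"
  by (simp add: order_def dihedral_def card_cartesian_product)


section \<open>The numbers \<open>k\<^sub>j\<close> and \<open>t\<^sub>j\<close>\<close>

text \<open>
  The inverse modulo \<open>n\<close> is taken in \<^typ>\<open>int\<close>, so that the subtraction is not truncated;
  the choice of inverse does not affect the gcd. Both functions are meaningful only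
  for \<open>1 \<le> j \<le> n\<close> with \<open>j\<close> coprime to \<open>n\<close>.
\<close>

definition kk :: "nat \<Rightarrow> nat \<Rightarrow> nat" where
  "kk n j = (if j = 1 then n else
     card {m \<in> {1..int n}. \<exists>l::nat.
       m = 1 + int l * (int n div gcd (int n) (modular_inverse (int n) (int j) - 1))})"

text \<open>
  \<open>t\<^sub>j\<close> is real-valued, since the average in its definition is not visibly an integer.
  For \<open>1 < j \<le> n\<close> coprime to \<open>n\<close> the residue \<open>j ^ m mod n\<close> lies in \<open>{1..n}\<close>.
\<close>

definition tt :: "nat \<Rightarrow> nat \<Rightarrow> real" where
  "tt n j = (if j = 1 then 0 else
     (1 / real (ord n j)) * (\<Sum>m = 1..ord n j. real (kk n (j ^ m mod n))) - real (kk n j))"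

end

theory Submission
  imports Defs "HOL-Algebra.Group_Action"
begin

text \<open>
  Let \<open>b\<close> be a reflection. A left transversal of \<open>{1, b}\<close> amounts to the set
  \<open>B \<subseteq> \<int>\<^sub>n - {0}\<close> of the cosets represented by a reflection, and the induced operation on
  \<open>\<int>\<^sub>n\<close> is \<open>i \<circ> j = i - j\<close> if \<open>i \<in> B\<close> and \<open>i \<circ> j = i + j\<close> otherwise. Comparing the left
  multiplications by two neighbours \<open>i\<close>, \<open>i + 1\<close> shows that an isomorphism of two such operations
  is multiplication by a unit, unless both sets consist of the odd residues. So the isomorphism
  classes are the orbits of \<open>U\<^sub>n\<close> on the subsets of \<open>\<int>\<^sub>n - {0}\<close>. By Burnside's lemma their number is
  the average over \<open>j \<in> U\<^sub>n\<close> of \<open>2\<close> to the number of cycles of multiplication by \<open>j\<close> on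
  \<open>\<int>\<^sub>n - {0}\<close>; by Burnside's lemma for the group generated by \<open>j\<close>, this number of cycles is
  \<open>t\<^sub>j + k\<^sub>j - 1\<close>, because \<open>k\<^sub>j = gcd(n, j - 1)\<close> counts the fixed points of \<open>j\<close> on \<open>\<int>\<^sub>n\<close>.
\<close>

section \<open>Group actions and invariant subsets\<close>

text \<open>Actions are homomorphisms into \<open>BijGroup E\<close>, whose elements are
  extensional; hence the restriction to \<open>E\<close>. Bijectivity comes from the inverse map
  \<open>f (inv g)\<close>.\<close>

lemma group_actionI:
  fixes G (structure)
  assumes "group G"
    and closed: "\<And>g x. g \<in> carrier G \<Longrightarrow> x \<in> E \<Longrightarrow> f g x \<in> E"
    and one: "\<And>x. x \<in> E \<Longrightarrow> f \<one> x = x"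
    and mult: "\<And>g h x. g \<in> carrier G \<Longrightarrow> h \<in> carrier G \<Longrightarrow> x \<in> E \<Longrightarrow> f (g \<otimes> h) x = f g (f h x)"
  shows "group_action G E (\<lambda>g. \<lambda>x\<in>E. f g x)"
proof -
  interpret group G by fact
  have Bij: "(\<lambda>x\<in>E. f g x) \<in> Bij E" if g: "g \<in> carrier G" for g
  proof -
    have "bij_betw (f g) E E"
    proof (rule bij_betw_byWitness[where f' = "f (inv g)"])
      show "\<forall>x\<in>E. f (inv g) (f g x) = x" "\<forall>x\<in>E. f g (f (inv g) x) = x"
        using g by (simp_all flip: mult add: one)
    qed (use closed g in auto)
    then show ?thesis
      by (simp add: Bij_def)
  qed
  have "(\<lambda>g. \<lambda>x\<in>E. f g x) \<in> hom G (BijGroup E)"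
    by (rule homI) (auto simp: BijGroup_def Bij compose_def closed mult cong: restrict_cong)
  then show ?thesis
    by (simp add: group_action_def group_hom_def group_hom_axioms_def group_BijGroup assms(1))
qed

definition on_subsets :: "'b set \<Rightarrow> ('a \<Rightarrow> 'b \<Rightarrow> 'b) \<Rightarrow> 'a \<Rightarrow> 'b set \<Rightarrow> 'b set" where
  "on_subsets E f = (\<lambda>g. \<lambda>B\<in>Pow E. f g ` B)"

context group_action
begin

lemma group_action_on_subsets: "group_action G (Pow E) (on_subsets E \<phi>)"
  unfolding on_subsets_def
proof (rule group_actionI)
  show "group G"
    using group_hom by (simp add: group_hom_def)
next
  fix g x assume "g \<in> carrier G" "x \<in> Pow E"
  then show "\<phi> g ` x \<in> Pow E"
    using element_image by auto
next
  fix x assume "x \<in> Pow E"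
  then show "\<phi> \<one> ` x = x"
    by (auto simp flip: id_eq_one simp: subset_iff)
next
  fix g h x assume "g \<in> carrier G" "h \<in> carrier G" "x \<in> Pow E"
  then show "\<phi> (g \<otimes> h) ` x = \<phi> g ` \<phi> h ` x"
    by (auto simp: image_image subset_iff composition_rule intro!: image_cong)
qed

lemma orbit_eq_if_mem:
  assumes "x \<in> E" "y \<in> orbit G \<phi> x"
  shows "orbit G \<phi> y = orbit G \<phi> x"
proof -
  have sub: "orbit G \<phi> z \<subseteq> E" if "z \<in> E" for z
    using that element_image by (auto simp: orbit_def)
  show ?thesis
    using assms sub orbit_trans orbit_sym by (meson subsetD subsetI subset_antisym)
qed

text \<open>An invariant subset is a union of orbits, in exactly one way because orbits are nonempty
  and pairwise disjoint. Hence \<open>Union\<close> is a bijection from the sets of orbits to the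
  invariant subsets.\<close>

lemma card_unions_of_orbits:
  assumes "finite E"
  shows "card {B \<in> Pow E. \<forall>g\<in>carrier G. \<phi> g ` B = B} = 2 ^ card (orbits G E \<phi>)"
proof -
  interpret grp: group G
    using group_hom by (simp add: group_hom_def)
  have "bij_betw Union (Pow (orbits G E \<phi>)) {B \<in> Pow E. \<forall>g\<in>carrier G. \<phi> g ` B = B}"
    unfolding bij_betw_def
  proof
    show "inj_on Union (Pow (orbits G E \<phi>))"
    proof (rule inj_onI)
      fix P Q assume *: "P \<in> Pow (orbits G E \<phi>)" "Q \<in> Pow (orbits G E \<phi>)" "\<Union> P = \<Union> Q"
      have "X \<in> Q'" if "X \<in> P'" "P' \<subseteq> orbits G E \<phi>" "Q' \<subseteq> orbits G E \<phi>" "\<Union> P' = \<Union> Q'" for X P' Q'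
      proof -
        have X: "X \<in> orbits G E \<phi>"
          using that(1,2) by blast
        then obtain x where x: "x \<in> E" "X = orbit G \<phi> x"
          unfolding orbits_def by blast
        then have "x \<in> X"
          using orbit_refl by simp
        then have "x \<in> \<Union> Q'"
          using that(1) unfolding that(4)[symmetric] by (rule UnionI[rotated])
        then obtain Y where Y: "Y \<in> Q'" "x \<in> Y"
          by blast
        have "Y \<in> orbits G E \<phi>"
          using Y(1) that(3) by (rule rev_subsetD)
        then have "Y = X"
          using disjoint_union[OF X, of Y] Y(2) \<open>x \<in> X\<close> by auto
        with Y show ?thesis by simp
      qed
      note sub = this
      show "P = Q"
        using * sub[of _ P Q] sub[of _ Q P] by (intro equalityI subsetI) simp_all
    qed
    show "Union ` Pow (orbits G E \<phi>) = {B \<in> Pow E. \<forall>g\<in>carrier G. \<phi> g ` B = B}"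
    proof (intro equalityI subsetI)
      fix B assume "B \<in> Union ` Pow (orbits G E \<phi>)"
      then obtain P where P: "P \<subseteq> orbits G E \<phi>" "B = \<Union> P" by auto
      then have "B \<subseteq> E"
        using orbits_coverture by blast
      have sub: "\<phi> g ` B \<subseteq> B" if "g \<in> carrier G" for g
      proof
        fix y assume "y \<in> \<phi> g ` B"
        then obtain x X where x: "x \<in> X" "X \<in> P" "y = \<phi> g x"
          using P by auto
        then obtain x0 where x0: "x0 \<in> E" "X = orbit G \<phi> x0"
          using P by (auto simp: orbits_def)
        have "orbit G \<phi> x = X"
          using x x0 orbit_eq_if_mem by simp
        then have "y \<in> X"
          using x that by (auto simp: orbit_def)
        with x P show "y \<in> B" by auto
      qed
      have "\<phi> g ` B = B" if g: "g \<in> carrier G" for g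
      proof (rule card_subset_eq)
        show "card (\<phi> g ` B) = card B"
          using inj_prop[OF g] \<open>B \<subseteq> E\<close> by (intro card_image) (rule inj_on_subset)
      qed (use sub[OF g] finite_subset[OF \<open>B \<subseteq> E\<close> assms] in auto)
      with \<open>B \<subseteq> E\<close> show "B \<in> {B \<in> Pow E. \<forall>g\<in>carrier G. \<phi> g ` B = B}" by auto
    next
      fix B assume B: "B \<in> {B \<in> Pow E. \<forall>g\<in>carrier G. \<phi> g ` B = B}"
      have "orbit G \<phi> x \<subseteq> B" if "x \<in> B" for x
        using B that by (auto simp: orbit_def)
      moreover have "x \<in> orbit G \<phi> x" if "x \<in> B" for x
        using B that by (intro orbit_refl) auto
      ultimately have "B = \<Union> (orbit G \<phi> ` B)"
        by blast
      moreover have "orbit G \<phi> ` B \<in> Pow (orbits G E \<phi>)"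
        using B by (auto simp: orbits_def)
      ultimately show "B \<in> Union ` Pow (orbits G E \<phi>)" by blast
    qed
  qed
  moreover have "finite (orbits G E \<phi>)"
    using assms by (metis finite_UnionD orbits_coverture)
  ultimately show ?thesis
    by (simp add: card_Pow flip: bij_betw_same_card)
qed

text \<open>The stabilizer of a set is a subgroup, so a set fixed by \<open>g\<close> is fixed by
  the whole cyclic subgroup generated by \<open>g\<close>. It remains to count the unions of orbits
  of that subgroup.\<close>

lemma card_fixed_subsets:
  assumes "finite E" "g \<in> carrier G"
  shows "card (invariants (Pow E) (on_subsets E \<phi>) g) =
    2 ^ card (orbits (G\<lparr>carrier := generate G {g}\<rparr>) E \<phi>)"
proof -
  interpret grp: group G
    using group_hom by (simp add: group_hom_def)
  interpret P: group_action G "Pow E" "on_subsets E \<phi>"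
    by (rule group_action_on_subsets)
  have sub: "subgroup (generate G {g}) G"
    using assms by (intro grp.generate_is_subgroup) auto
  interpret H: group_action "G\<lparr>carrier := generate G {g}\<rparr>" E \<phi>
    by (rule induced_action[OF sub])
  have "invariants (Pow E) (on_subsets E \<phi>) g = {B \<in> Pow E. \<forall>h\<in>generate G {g}. \<phi> h ` B = B}"
  proof (intro equalityI subsetI)
    fix B assume B: "B \<in> invariants (Pow E) (on_subsets E \<phi>) g"
    then have "subgroup (stabilizer G (on_subsets E \<phi>) B) G"
      by (intro P.stabilizer_subgroup) (auto simp: invariants_def)
    moreover have "{g} \<subseteq> stabilizer G (on_subsets E \<phi>) B"
      using B assms by (auto simp: invariants_def stabilizer_def)
    ultimately have "generate G {g} \<subseteq> stabilizer G (on_subsets E \<phi>) B"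
      by (intro grp.generate_subgroup_incl)
    with B show "B \<in> {B \<in> Pow E. \<forall>h\<in>generate G {g}. \<phi> h ` B = B}"
      by (auto simp: invariants_def stabilizer_def on_subsets_def)
  qed (auto simp: invariants_def on_subsets_def generate.incl)
  then show ?thesis
    using H.card_unions_of_orbits[OF assms(1)] by simp
qed

text \<open>Burnside's lemma for the cyclic subgroup generated by \<open>g\<close>, its elements
  listed as powers with exponents from 1 to the order, as in the sum defining
  \<open>tt\<close>.\<close>

lemma card_orbits_cyclic:
  assumes "finite (carrier G)" "finite E" "g \<in> carrier G"
  shows "card (orbits (G\<lparr>carrier := generate G {g}\<rparr>) E \<phi>) * group.ord G g =
    (\<Sum>m = 1..group.ord G g. card (invariants E \<phi> (g [^] m)))"
proof -
  interpret grp: group G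
    using group_hom by (simp add: group_hom_def)
  have sub: "subgroup (generate G {g}) G"
    using assms by (intro grp.generate_is_subgroup) auto
  interpret H: group_action "G\<lparr>carrier := generate G {g}\<rparr>" E \<phi>
    by (rule induced_action[OF sub])
  have fin: "finite (generate G {g})"
    using sub assms(1) by (meson finite_subset subgroup.subset)
  have "(\<lambda>m. g [^] m) ` {1..grp.ord g} = generate G {g}"
  proof (rule card_subset_eq[OF fin])
    show "(\<lambda>m. g [^] m) ` {1..grp.ord g} \<subseteq> generate G {g}"
      using assms(3) grp.generate_pow_nat[OF assms(3)] grp.ord_ge_1[OF assms(1,3)] by auto
    show "card ((\<lambda>m. g [^] m) ` {1..grp.ord g}) = card (generate G {g})"
      using grp.generate_pow_card[OF assms(3)] card_image[OF grp.ord_inj'[OF assms(3)]] by simp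
  qed
  then have "(\<Sum>h\<in>generate G {g}. card (invariants E \<phi> h)) =
    (\<Sum>m = 1..grp.ord g. card (invariants E \<phi> (g [^] m)))"
    using sum.reindex[OF grp.ord_inj'[OF assms(3)], of "\<lambda>h. card (invariants E \<phi> h)"] by simp
  moreover have "order (G\<lparr>carrier := generate G {g}\<rparr>) = grp.ord g"
    by (simp add: order_def grp.generate_pow_card[OF assms(3)])
  ultimately show ?thesis
    using H.burnside fin assms(2) by simp
qed

end


section \<open>Multiplication by units modulo \<open>n\<close>\<close>

lemma card_multiples_div:
  fixes d n :: int
  assumes "n > 0" "d dvd n" "d > 0"
  shows "card {x \<in> {0..<n}. n div d dvd x} = nat d"
proof -
  define e where "e = n div d"
  have n: "n = e * d" and e: "e > 0"
    using assms by (auto simp: e_def pos_imp_zdiv_pos_iff zdvd_imp_le)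
  have "{x \<in> {0..<n}. e dvd x} = (\<lambda>k. e * k) ` {0..<d}"
    using e by (auto simp: n zero_le_mult_iff elim!: dvdE)
  moreover have "inj_on (\<lambda>k. e * k) {0..<d}"
    using e by (auto simp: inj_on_def)
  ultimately show ?thesis
    by (simp add: card_image flip: e_def)
qed

lemma dvd_mult_iff_div_gcd_dvd:
  fixes a n x :: int
  assumes "n \<noteq> 0"
  shows "n dvd a * x \<longleftrightarrow> n div gcd n a dvd x"
proof -
  obtain n' a' where *: "n = n' * gcd n a" "a = a' * gcd n a" "coprime n' a'"
    using gcd_coprime_exists[of n a] assms by auto
  have g: "gcd n a \<noteq> 0"
    using assms by simp
  have "n dvd a * x \<longleftrightarrow> n' * gcd n a dvd (a' * x) * gcd n a"
    using * by (metis mult.assoc mult.commute)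
  also have "\<dots> \<longleftrightarrow> n' dvd x"
    using g *(3) assms by (simp add: coprime_dvd_mult_right_iff)
  also have "n' = n div gcd n a"
    using * g by (metis nonzero_mult_div_cancel_right)
  finally show ?thesis .
qed

text \<open>Being fixed means \<open>n dvd (u - 1) * x\<close>, that is, \<open>x\<close> is a
  multiple of \<open>n div gcd n (u - 1)\<close>. The subtracted 1 removes the fixed point
  0.\<close>

lemma card_fixed_points_mult:
  fixes n u :: int
  assumes "n > 0"
  shows "card {x \<in> {1..<n}. u * x mod n = x} = nat (gcd n (u - 1)) - 1"
proof -
  have "u * x mod n = x \<longleftrightarrow> n div gcd n (u - 1) dvd x" if "x \<in> {0..<n}" for x
  proof -
    have "u * x mod n = x \<longleftrightarrow> n dvd (u - 1) * x"
      using that by (metis atLeastLessThan_iff left_diff_distrib mod_eq_dvd_iff mod_pos_pos_trivial mult_1)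
    then show ?thesis
      using assms by (simp add: dvd_mult_iff_div_gcd_dvd)
  qed
  then have "{x \<in> {0..<n}. u * x mod n = x} = {x \<in> {0..<n}. n div gcd n (u - 1) dvd x}"
    by blast
  then have "card {x \<in> {0..<n}. u * x mod n = x} = nat (gcd n (u - 1))"
    using card_multiples_div[of n "gcd n (u - 1)"] assms by simp
  moreover have "{x \<in> {0..<n}. u * x mod n = x} = insert 0 {x \<in> {1..<n}. u * x mod n = x}"
    using assms by auto
  moreover have "finite {x \<in> {1..<n}. u * x mod n = x}"
    by (rule finite_subset[of _ "{1..<n}"]) auto
  ultimately show ?thesis by simp
qed

text \<open>With \<open>i\<close> the inverse of \<open>j\<close>,
  \<open>j - 1 = (j * i - 1) - j * (i - 1)\<close> and
  \<open>i - 1 = (j * i - 1) - i * (j - 1)\<close>, so a common divisor of \<open>n\<close> and one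
  of them divides the other. This replaces the inverse in \<open>kk\<close> by \<open>j\<close>
  itself.\<close>

lemma gcd_modular_inverse_minus_1:
  fixes n j :: int
  assumes "coprime j n"
  shows "gcd n (modular_inverse n j - 1) = gcd n (j - 1)"
proof -
  let ?i = "modular_inverse n j"
  have n: "n dvd j * ?i - 1"
    using cong_modular_inverse1[OF assms] by (simp add: cong_iff_dvd_diff)
  have "d dvd j - 1" if "d dvd n" "d dvd ?i - 1" for d
  proof -
    have "d dvd (j * ?i - 1) - j * (?i - 1)"
      using that n by (meson dvd_diff dvd_mult dvd_trans)
    then show ?thesis by (simp add: algebra_simps)
  qed
  moreover have "d dvd ?i - 1" if "d dvd n" "d dvd j - 1" for d
  proof -
    have "d dvd (j * ?i - 1) - ?i * (j - 1)"
      using that n by (meson dvd_diff dvd_mult dvd_trans)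
    then show ?thesis by (simp add: algebra_simps)
  qed
  ultimately show ?thesis
    by (intro gcd_unique[THEN iffD1, symmetric] conjI) auto
qed

text \<open>Subtracting 1 takes the admissible \<open>m\<close> to the multiples of \<open>e\<close>
  in \<open>{0..<n}\<close>. For \<open>j = 1\<close> the gcd with 0 is \<open>n\<close>, in
  agreement with the separate clause of \<open>kk\<close>.\<close>

lemma kk_eq_gcd:
  assumes "n > 0" "coprime j n"
  shows "kk n j = nat (gcd (int n) (int j - 1))"
proof (cases "j = 1")
  case False
  define d where "d = gcd (int n) (int j - 1)"
  define e where "e = int n div d"
  have d: "d > 0" "d dvd int n" and e: "e > 0"
    using assms by (auto simp: d_def e_def pos_imp_zdiv_pos_iff zdvd_imp_le)
  have "coprime (int j) (int n)"
    using assms by simp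
  then have d': "gcd (int n) (modular_inverse (int n) (int j) - 1) = d"
    by (simp add: d_def gcd_modular_inverse_minus_1)
  have *: "(\<exists>l::nat. m = 1 + int l * e) \<longleftrightarrow> e dvd m - 1" if "m \<ge> 1" for m
  proof
    assume "e dvd m - 1"
    then obtain l where l: "m - 1 = e * l" by auto
    then have "l \<ge> 0"
      using that e by (metis diff_ge_0_iff_ge zero_le_mult_iff not_less)
    with l have "m = 1 + int (nat l) * e" by (simp add: algebra_simps)
    then show "\<exists>l::nat. m = 1 + int l * e" by blast
  qed auto
  have "{m \<in> {1..int n}. \<exists>l::nat. m = 1 + int l * e} = (\<lambda>x. x + 1) ` {x \<in> {0..<int n}. e dvd x}"
  proof (intro equalityI subsetI)
    fix m assume m: "m \<in> {m \<in> {1..int n}. \<exists>l::nat. m = 1 + int l * e}"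
    then have "m - 1 \<in> {x \<in> {0..<int n}. e dvd x}"
      using *[of m] by auto
    then show "m \<in> (\<lambda>x. x + 1) ` {x \<in> {0..<int n}. e dvd x}"
      by (rule rev_image_eqI) simp
  next
    fix m assume "m \<in> (\<lambda>x. x + 1) ` {x \<in> {0..<int n}. e dvd x}"
    then show "m \<in> {m \<in> {1..int n}. \<exists>l::nat. m = 1 + int l * e}"
      using *[of m] by auto
  qed
  then have "kk n j = card {x \<in> {0..<int n}. e dvd x}"
    using False by (simp add: kk_def d' card_image flip: e_def)
  then show ?thesis
    using card_multiples_div[of "int n" d] d assms(1) by (simp add: e_def d_def)
qed (simp add: kk_def)

text \<open>0 is left out because the coset of the identity must be represented by the identity, so
  the sets to be acted on never contain 0.\<close>

definition mult_action :: "int \<Rightarrow> int \<Rightarrow> int \<Rightarrow> int" where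
  "mult_action n = (\<lambda>u. \<lambda>x\<in>{1..<n}. u * x mod n)"

section \<open>The unit group acting on the nonzero residues\<close>

context residues
begin

lemma mult_mod_in_range:
  assumes "u \<in> Units R" "x \<in> {1..<m}"
  shows "u * x mod m \<in> {1..<m}"
proof -
  have "coprime u m" 
    using assms by (simp add: res_units_eq)
  then have "\<not> m dvd u * x"
    using assms by (simp add: coprime_commute coprime_dvd_mult_right_iff zdvd_not_zless)
  then show ?thesis
    using m_gt_one by (smt (verit) atLeastLessThan_iff dvd_eq_mod_eq_0 pos_mod_bound pos_mod_sign)
qed

lemma group_action_mult: "group_action (units_of R) {1..<m} (mult_action m)"
  unfolding mult_action_def
proof (rule group_actionI)
  show "group (units_of R)"
    by (rule units_group)
qed (auto simp: units_of_carrier units_of_mult units_of_one res_mult_eq res_one_eq mod_simps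
  mult.assoc simp del: atLeastLessThan_iff intro: mult_mod_in_range, simp)

lemma units_nat_pow:
  assumes "u \<in> Units R"
  shows "u [^]\<^bsub>units_of R\<^esub> k = u ^ k mod m"
proof -
  have "u [^]\<^bsub>units_of R\<^esub> k = u [^] k"
    using assms by (induction k) (simp_all add: units_of_one units_of_mult)
  also have "\<dots> = u ^ k mod m"
    using assms pow_cong[of u k] by (simp add: res_units_eq)
  finally show ?thesis .
qed

lemma card_invariants_mult_action:
  "card (invariants {1..<m} (mult_action m) u) = nat (gcd m (u - 1)) - 1"
proof -
  have "invariants {1..<m} (mult_action m) u = {x \<in> {1..<m}. u * x mod m = x}"
    by (auto simp: invariants_def mult_action_def)
  then show ?thesis
    using card_fixed_points_mult[of m u] m_gt_one by simp
qed

end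

text \<open>Both orders have the same multiples, namely the exponents \<open>k\<close> with
  \<open>j ^ k\<close> congruent to 1, so they divide each other.\<close>

lemma ord_units_residue_ring:
  assumes "n > 1" "coprime j n" "j \<le> n"
  shows "group.ord (units_of (residue_ring (int n))) (int j) = ord n j"
proof -
  let ?R = "residue_ring (int n)"
  interpret residues "int n" ?R
    using assms by unfold_locales auto
  interpret U: group "units_of ?R"
    by (rule units_group)
  \<comment> \<open>Coprimality to \<open>n > 1\<close> excludes \<open>j = 0\<close> and
    \<open>j = n\<close>, so \<open>j\<close> is itself an element of the ring.\<close>
  have j: "int j \<in> Units ?R"
    using assms by (auto simp: res_units_eq intro!: Nat.gr0I le_neq_implies_less)
  then have jc: "int j \<in> carrier (units_of ?R)"
    by (simp add: units_of_carrier)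
  have "U.ord (int j) dvd k \<longleftrightarrow> ord n j dvd k" for k
  proof -
    have "U.ord (int j) dvd k \<longleftrightarrow> int (j ^ k mod n) = int 1"
      using U.pow_eq_id[OF jc, of k]
      by (simp add: units_nat_pow[OF j] units_of_one res_one_eq zmod_int)
    also have "\<dots> \<longleftrightarrow> [j ^ k = 1] (mod n)"
      using assms(1) by (simp add: cong_def)
    finally show ?thesis
      by (simp add: ord_divides')
  qed
  then show ?thesis
    by (meson dvd_antisym dvd_refl)
qed

text \<open>Burnside's lemma for the subgroup generated by \<open>j\<close>: the power
  \<open>j ^ k\<close> fixes \<open>kk n (j ^ k mod n) - 1\<close> nonzero residues, and the average
  over one period is the number of orbits.\<close>

lemma card_orbits_mult_action_cyclic:
  assumes n: "n > 1" and j: "coprime j n" "j \<le> n"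
  shows "real (card (orbits
      ((units_of (residue_ring (int n)))\<lparr>carrier := generate (units_of (residue_ring (int n))) {int j}\<rparr>)
      {1..<int n} (mult_action (int n)))) = tt n j + real (kk n j) - 1" (is "real ?c = _")
proof -
  let ?R = "residue_ring (int n)"
  interpret residues "int n" ?R
    using assms by unfold_locales auto
  interpret A: group_action "units_of ?R" "{1..<int n}" "mult_action (int n)"
    by (rule group_action_mult)
  have jR: "int j \<in> Units ?R"
    using assms by (auto simp: res_units_eq intro!: Nat.gr0I le_neq_implies_less)
  define d where "d = ord n j"
  have d: "d > 0"
    using j by (simp add: d_def coprime_commute)
  have kk: "real (card (invariants {1..<int n} (mult_action (int n)) (int j [^]\<^bsub>units_of ?R\<^esub> k))) =
      real (kk n (j ^ k mod n)) - 1" for k :: nat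
  proof -
    have "kk n (j ^ k mod n) = nat (gcd (int n) (int (j ^ k mod n) - 1))"
      using j n by (intro kk_eq_gcd) auto
    \<comment> \<open>The gcd is at least 1, so the natural-number subtraction of the fixed point 0
      is not truncated.\<close>
    moreover have "gcd (int n) (int (j ^ k mod n) - 1) \<ge> 1"
      using n by (simp add: int_one_le_iff_zero_less)
    ultimately show ?thesis
      by (simp add: units_nat_pow[OF jR] card_invariants_mult_action zmod_int of_nat_diff)
  qed
  have "?c * d = (\<Sum>k = 1..d. card (invariants {1..<int n} (mult_action (int n)) (int j [^]\<^bsub>units_of ?R\<^esub> k)))"
    using A.card_orbits_cyclic[of "int j"] jR ord_units_residue_ring[OF n j]
    by (simp add: units_of_carrier d_def)
  then have "real (?c * d) = real (\<Sum>k = 1..d. card (invariants {1..<int n} (mult_action (int n)) (int j [^]\<^bsub>units_of ?R\<^esub> k)))"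
    by (rule arg_cong)
  then have "real ?c * d = (\<Sum>k = 1..d. real (kk n (j ^ k mod n)) - 1)"
    by (simp only: of_nat_mult of_nat_sum kk)
  then have "real ?c * d = (\<Sum>k = 1..d. real (kk n (j ^ k mod n))) - d"
    by (simp add: sum_subtractf)
  then have "real ?c = 1 / real d * (\<Sum>k = 1..d. real (kk n (j ^ k mod n))) - 1"
    using d by (simp add: field_simps)
  \<comment> \<open>For \<open>j = 1\<close> the order is 1 and the average is
    \<open>kk n 1\<close>, which agrees with the convention \<open>tt n 1 = 0\<close>.\<close>
  then show ?thesis
    using n by (auto simp: tt_def d_def)
qed

lemma Units_residue_ring_eq:
  assumes "n > 1"
  shows "Units (residue_ring (int n)) = int ` {j. 1 \<le> j \<and> j \<le> n \<and> coprime j n}"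
proof -
  let ?R = "residue_ring (int n)"
  interpret residues "int n" ?R
    using assms by unfold_locales auto
  have "{j. 1 \<le> j \<and> j \<le> n \<and> coprime j n} = totatives n"
    by (auto simp: totatives_def)
  then have "nat ` Units ?R = {j. 1 \<le> j \<and> j \<le> n \<and> coprime j n}"
    using totatives_eq by simp
  moreover have "int ` nat ` Units ?R = Units ?R"
    by (force simp: image_image res_units_eq)
  ultimately show ?thesis by simp
qed

text \<open>Burnside's lemma for the whole unit group, of order \<open>totient n\<close>. The number
  of subsets fixed by \<open>j\<close> is 2 to the number of cycles of \<open>j\<close>, which is
  already known in terms of \<open>tt\<close> and \<open>kk\<close>.\<close>

lemma card_orbits_subsets_mult_action:
  assumes "n > 1"
  shows "real (card (orbits (units_of (residue_ring (int n))) (Pow {1..<int n})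
      (on_subsets {1..<int n} (mult_action (int n))))) =
    (1 / real (totient n)) *
      (\<Sum>j | 1 \<le> j \<and> j \<le> n \<and> coprime j n. 2 powr (tt n j + real (kk n j) - 1))"
proof -
  let ?R = "residue_ring (int n)"
  interpret residues "int n" ?R
    using assms by unfold_locales auto
  interpret A: group_action "units_of ?R" "{1..<int n}" "mult_action (int n)"
    by (rule group_action_mult)
  interpret P: group_action "units_of ?R" "Pow {1..<int n}" "on_subsets {1..<int n} (mult_action (int n))"
    by (rule A.group_action_on_subsets)
  let ?inv = "\<lambda>u. card (invariants (Pow {1..<int n}) (on_subsets {1..<int n} (mult_action (int n))) u)"
  let ?c = "card (orbits (units_of ?R) (Pow {1..<int n}) (on_subsets {1..<int n} (mult_action (int n))))"
  have "?c * totient n = (\<Sum>u\<in>Units ?R. ?inv u)"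
    using P.burnside totient_eq by (simp add: units_of_carrier order_def)
  also have "\<dots> = (\<Sum>j | 1 \<le> j \<and> j \<le> n \<and> coprime j n. ?inv (int j))"
    by (simp add: Units_residue_ring_eq[OF assms] sum.reindex)
  finally have "real (?c * totient n) = real (\<Sum>j | 1 \<le> j \<and> j \<le> n \<and> coprime j n. ?inv (int j))"
    by (rule arg_cong)
  then have "real ?c * totient n = (\<Sum>j | 1 \<le> j \<and> j \<le> n \<and> coprime j n. real (?inv (int j)))"
    by (simp only: of_nat_mult of_nat_sum)
  also have "\<dots> = (\<Sum>j | 1 \<le> j \<and> j \<le> n \<and> coprime j n. 2 powr (tt n j + real (kk n j) - 1))"
  proof (rule sum.cong)
    fix j assume j: "j \<in> {j. 1 \<le> j \<and> j \<le> n \<and> coprime j n}"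
    then have "int j \<in> carrier (units_of ?R)"
      by (simp add: units_of_carrier Units_residue_ring_eq[OF assms])
    with j show "real (?inv (int j)) = 2 powr (tt n j + real (kk n j) - 1)"
      by (simp add: A.card_fixed_subsets powr_realpow flip: card_orbits_mult_action_cyclic[OF assms])
  qed simp
  finally show ?thesis
    using assms by (simp add: field_simps)
qed


section \<open>Operations that add or subtract modulo \<open>n\<close>\<close>

text \<open>
  Identifying the left coset of \<open>a\<^sup>i\<close> with \<open>i\<close>, the left transversal that picks the reflection
  exactly in the cosets \<open>i \<in> B\<close> induces this operation on \<open>\<int>\<^sub>n\<close>; it does not depend on the
  choice of the reflection \<open>b\<close>.
\<close>

definition reflect_op :: "int \<Rightarrow> int set \<Rightarrow> int \<Rightarrow> int \<Rightarrow> int" where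
  "reflect_op n B i j = (if i \<in> B then i - j else i + j) mod n"

definition reflect_iso :: "int \<Rightarrow> int set \<Rightarrow> int set \<Rightarrow> bool" where
  "reflect_iso n A B \<longleftrightarrow> (\<exists>p. bij_betw p {0..<n} {0..<n} \<and>
     (\<forall>i\<in>{0..<n}. \<forall>j\<in>{0..<n}. p (reflect_op n A i j) = reflect_op n B (p i) (p j)))"

lemma reflect_op_in_range: "n > 0 \<Longrightarrow> reflect_op n B i j \<in> {0..<n}"
  by (simp add: reflect_op_def)

section \<open>Isomorphisms and multiplication by units\<close>

lemma reflect_iso_sym:
  assumes "n > 0" "reflect_iso n A B"
  shows "reflect_iso n B A"
proof -
  obtain p where p: "bij_betw p {0..<n} {0..<n}"
    "\<And>i j. i \<in> {0..<n} \<Longrightarrow> j \<in> {0..<n} \<Longrightarrow> p (reflect_op n A i j) = reflect_op n B (p i) (p j)"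
    using assms(2) unfolding reflect_iso_def by blast
  define q where "q = inv_into {0..<n} p"
  have q: "bij_betw q {0..<n} {0..<n}"
    unfolding q_def by (rule bij_betw_inv_into[OF p(1)])
  have qp: "q (p i) = i" if "i \<in> {0..<n}" for i
    unfolding q_def using that by (rule bij_betw_inv_into_left[OF p(1)])
  have pq: "p (q i) = i" if "i \<in> {0..<n}" for i
    unfolding q_def using that by (rule bij_betw_inv_into_right[OF p(1)])
  have "q (reflect_op n B i j) = reflect_op n A (q i) (q j)" if ij: "i \<in> {0..<n}" "j \<in> {0..<n}" for i j
  proof -
    have "q i \<in> {0..<n}" "q j \<in> {0..<n}"
      using q ij bij_betwE by blast+
    then have "p (reflect_op n A (q i) (q j)) = reflect_op n B i j"
      using p(2) pq ij by simp
    then show ?thesis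
      using qp[OF reflect_op_in_range[OF assms(1)]] by metis
  qed
  with q show ?thesis
    unfolding reflect_iso_def by blast
qed

text \<open>
  Write \<open>L\<^sub>i\<close> for left multiplication by \<open>i\<close>. If \<open>i\<close> and \<open>i + 1\<close> are of the same kind, then
  \<open>L\<^sub>i\<^sub>+\<^sub>1 \<circ> L\<^sub>i\<inverse>\<close> is the translation by 1 (\<open>step\<close> below). Its conjugate by \<open>p\<close> is a translation
  or a reflection, and the latter is excluded since it is an involution and \<open>n > 2\<close>.
\<close>

lemma reflect_iso_mult:
  fixes n :: int
  assumes n: "n > 2" and AB: "0 \<notin> A" "0 \<notin> B"
    and p: "bij_betw p {0..<n} {0..<n}"
    and hom: "\<And>i j. i \<in> {0..<n} \<Longrightarrow> j \<in> {0..<n} \<Longrightarrow> p (reflect_op n A i j) = reflect_op n B (p i) (p j)"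
    and i: "i \<in> {0..<n}" "i \<in> A \<longleftrightarrow> (i + 1) mod n \<in> A"
  obtains u where "u \<in> {0..<n}" "coprime u n" "\<And>x. x \<in> {0..<n} \<Longrightarrow> p x = u * x mod n"
proof -
  define k where "k = (i + 1) mod n"
  have k: "k \<in> {0..<n}"
    using n by (simp add: k_def)
  have p_range: "p x \<in> {0..<n}" if "x \<in> {0..<n}" for x
    using p that bij_betwE by blast
  have p_inj: "x = y" if "p x = p y" "x \<in> {0..<n}" "y \<in> {0..<n}" for x y
    using p that by (auto simp: bij_betw_def inj_on_def)
  have "0 \<in> {0..<n}"
    using n by simp
  \<comment> \<open>Obtained by applying \<open>p\<close> to the product of 0 with itself. If
    \<open>p 0\<close> lies in \<open>B\<close>, the right side is \<open>p 0 - p 0\<close>;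
    otherwise \<open>p 0\<close> is congruent to its double.\<close>
  have "p 0 = reflect_op n B (p 0) (p 0)"
    using hom[of 0 0] n by (simp add: reflect_op_def AB)
  then have p0: "p 0 = 0"
  proof (cases "p 0 \<in> B")
    case False
    then have "p 0 mod n = (p 0 + p 0) mod n"
      using \<open>p 0 = _\<close> p_range[OF \<open>0 \<in> {0..<n}\<close>] by (simp add: reflect_op_def)
    then have "n dvd p 0"
      by (simp add: mod_eq_dvd_iff)
    then show ?thesis
      using p_range[OF \<open>0 \<in> {0..<n}\<close>] zdvd_not_zless[of "p 0" n] by force
  qed (simp add: reflect_op_def)
  have step: "\<exists>y. p (x mod n) = reflect_op n B (p i) y \<and> p ((x + 1) mod n) = reflect_op n B (p k) y" for x
  proof -
    \<comment> \<open>The solution of \<open>reflect_op n A i y = x mod n\<close>; since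
      \<open>k\<close> is of the same kind as \<open>i\<close>, left multiplication by
      \<open>k\<close> sends it to \<open>x + 1\<close>.\<close>
    define y where "y = (if i \<in> A then i - x else x - i) mod n"
    have y: "y \<in> {0..<n}"
      using n by (simp add: y_def)
    have "reflect_op n A i y = x mod n"
      by (simp add: reflect_op_def y_def mod_simps)
    moreover have "reflect_op n A k y = (x + 1) mod n"
    proof (cases "i \<in> A")
      case True
      then have "reflect_op n A k y = ((i + 1) mod n - (i - x) mod n) mod n"
        using i(2) by (simp add: reflect_op_def y_def k_def)
      also have "\<dots> = (x + 1) mod n"
        by (simp only: mod_diff_eq) (simp add: algebra_simps)
      finally show ?thesis .
    next
      case False
      then have "reflect_op n A k y = ((i + 1) mod n + (x - i) mod n) mod n"
        using i(2) by (simp add: reflect_op_def y_def k_def)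
      also have "\<dots> = (x + 1) mod n"
        by (simp only: mod_add_eq) (simp add: algebra_simps)
      finally show ?thesis .
    qed
    ultimately show ?thesis
      using hom[OF i(1) y] hom[OF k y] by metis
  qed
  have same: "p i \<in> B \<longleftrightarrow> p k \<in> B"
  proof (rule ccontr)
    assume *: "\<not> ?thesis"
    \<comment> \<open>If the kinds differed, the conjugated translation would be a reflection and
      the sum of consecutive values of \<open>p\<close> constant. Then \<open>p 0 = p 2\<close>,
      against injectivity and \<open>n > 2\<close>.\<close>
    have "(p (x mod n) + p ((x + 1) mod n)) mod n = (p i + p k) mod n" for x
      using step[of x] * by (auto simp: reflect_op_def mod_simps)
    from this[of 0] this[of 1] have "(p 0 + p 1) mod n = (p 1 + p 2) mod n"
      using n by simp
    then have "n dvd p 0 - p 2"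
      by (simp add: mod_eq_dvd_iff)
    then have "p 0 mod n = p 2 mod n"
      by (simp add: mod_eq_dvd_iff)
    then have "p 0 = p 2"
      using p_range[of 0] p_range[of 2] n by simp
    then show False
      using p_inj[of 0 2] n by simp
  qed
  define u where "u = (p k - p i) mod n"
  \<comment> \<open>With equal kinds \<open>y\<close> cancels from the difference of the two values,
    so \<open>p\<close> grows by the constant \<open>u\<close> at every step; starting from
    \<open>p 0 = 0\<close> it is multiplication by \<open>u\<close>.\<close>
  have diff: "p ((x + 1) mod n) = (p (x mod n) + u) mod n" for x
  proof -
    obtain y where y: "p (x mod n) = reflect_op n B (p i) y" "p ((x + 1) mod n) = reflect_op n B (p k) y"
      using step by blast
    show ?thesis
    proof (cases "p i \<in> B")
      case True
      then have "(p (x mod n) + u) mod n = ((p i - y) mod n + (p k - p i) mod n) mod n"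
        using y by (simp add: reflect_op_def u_def)
      also have "\<dots> = (p k - y) mod n"
        by (simp only: mod_add_eq) (simp add: algebra_simps)
      finally show ?thesis
        using y same True by (simp add: reflect_op_def)
    next
      case False
      then have "(p (x mod n) + u) mod n = ((p i + y) mod n + (p k - p i) mod n) mod n"
        using y by (simp add: reflect_op_def u_def)
      also have "\<dots> = (p k + y) mod n"
        by (simp only: mod_add_eq) (simp add: algebra_simps)
      finally show ?thesis
        using y same False by (simp add: reflect_op_def)
    qed
  qed
  have p_nat: "p (int x mod n) = u * int x mod n" for x :: nat
  proof (induction x)
    case (Suc x)
    then show ?case
      using diff[of "int x"] by (simp add: mod_simps algebra_simps)
  qed (simp add: p0)
  have p_eq: "p x = u * x mod n" if "x \<in> {0..<n}" for x
    using p_nat[of "nat x"] that by simp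
  \<comment> \<open>Surjectivity of \<open>p\<close> supplies a preimage of 1, that is, an inverse
    of \<open>u\<close>.\<close>
  have "1 \<in> p ` {0..<n}"
    using p n by (simp add: bij_betw_def)
  then obtain x where "x \<in> {0..<n}" "u * x mod n = 1"
    using p_eq by auto
  then have "[u * x = 1] (mod n)"
    using n by (simp add: cong_def)
  then have "coprime u n"
    by (metis coprime_iff_invertible_int)
  moreover have "u \<in> {0..<n}"
    using n by (simp add: u_def)
  ultimately show ?thesis
    using p_eq that by blast
qed

lemma coprime_mult_eq_iff:
  fixes n u :: int
  assumes "coprime u n"
  shows "u * x mod n = u * y mod n \<longleftrightarrow> x mod n = y mod n"
  using assms cong_mult_lcancel[of u n x y] by (simp add: cong_def)

text \<open>If exactly one of \<open>i \<in> A\<close> and \<open>u * i mod n \<in> B\<close> held,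
  the product of \<open>i\<close> and 1 would give \<open>u * (i + 1) = u * (i - 1)\<close> modulo
  \<open>n\<close>, hence \<open>n dvd 2\<close>. So multiplication by \<open>u\<close> matches the
  two memberships.\<close>

lemma reflect_iso_image:
  fixes n :: int
  assumes n: "n > 2" and AB: "A \<subseteq> {1..<n}" "B \<subseteq> {1..<n}"
    and u: "coprime u n"
    and hom: "\<And>i j. i \<in> {0..<n} \<Longrightarrow> j \<in> {0..<n} \<Longrightarrow>
      u * reflect_op n A i j mod n = reflect_op n B (u * i mod n) (u * j mod n)"
  shows "B = (\<lambda>x. u * x mod n) ` A"
proof -
  have mem: "u * i mod n \<in> B \<longleftrightarrow> i \<in> A" if i: "i \<in> {0..<n}" for i
  proof (rule ccontr)
    assume *: "\<not> ?thesis"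
    have "u * (i + 1) mod n = u * (i - 1) mod n"
      using hom[OF i, of 1] * n by (auto simp: reflect_op_def mod_simps algebra_simps)
    then have "(i + 1) mod n = (i - 1) mod n"
      by (simp only: coprime_mult_eq_iff[OF u])
    then have "n dvd 2"
      by (simp add: mod_eq_dvd_iff)
    then show False
      using n by (simp add: zdvd_not_zless)
  qed
  obtain v where v: "[u * v = 1] (mod n)"
    using u coprime_iff_invertible_int by blast
  have surj: "u * (v * x mod n) mod n = x" if "x \<in> {0..<n}" for x
  proof -
    have "[u * v * x = 1 * x] (mod n)"
      by (rule cong_mult[OF v cong_refl])
    then show ?thesis
      using that by (simp add: cong_def mod_simps mult.assoc)
  qed
  show ?thesis
  proof (intro equalityI subsetI)
    fix x assume x: "x \<in> B"
    then have "u * (v * x mod n) mod n = x"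
      using AB by (intro surj) auto
    moreover have "v * x mod n \<in> A"
      using mem[of "v * x mod n"] x n calculation by (simp only: atLeastLessThan_iff) simp
    ultimately show "x \<in> (\<lambda>x. u * x mod n) ` A"
      by (metis imageI)
  next
    fix y assume "y \<in> (\<lambda>x. u * x mod n) ` A"
    then obtain x where "x \<in> A" "y = u * x mod n"
      by blast
    moreover from this have "x \<in> {0..<n}"
      using AB by auto
    ultimately show "y \<in> B"
      using mem by simp
  qed
qed

section \<open>Isomorphism classes as orbits of the unit group\<close>

context residues
begin

abbreviation "subset_orbit \<equiv> orbit (units_of R) (on_subsets {1..<m} (mult_action m))"

lemma mem_subset_orbit_iff:
  assumes "A \<subseteq> {1..<m}"
  shows "B \<in> subset_orbit A \<longleftrightarrow> (\<exists>u\<in>Units R. B = (\<lambda>x. u * x mod m) ` A)"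
proof -
  have "on_subsets {1..<m} (mult_action m) u A = (\<lambda>x. u * x mod m) ` A" for u
    using assms by (auto simp: on_subsets_def mult_action_def subset_iff intro!: image_cong)
  then show ?thesis
    by (auto simp: orbit_def units_of_carrier)
qed

text \<open>Stated for one ordered pair: neighbours of the same kind may be found in either set, and
  symmetry of \<open>reflect_iso\<close> exchanges the roles.\<close>

lemma reflect_iso_imp_orbit_aux:
  assumes m: "m > 2" and AB: "A \<subseteq> {1..<m}" "B \<subseteq> {1..<m}" and iso: "reflect_iso m A B"
    and i: "i \<in> {0..<m}" "i \<in> A \<longleftrightarrow> (i + 1) mod m \<in> A"
  shows "B \<in> subset_orbit A"
proof -
  obtain p where p: "bij_betw p {0..<m} {0..<m}"
    "\<And>i j. i \<in> {0..<m} \<Longrightarrow> j \<in> {0..<m} \<Longrightarrow> p (reflect_op m A i j) = reflect_op m B (p i) (p j)"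
    using iso unfolding reflect_iso_def by blast
  have "0 \<notin> A" "0 \<notin> B"
    using AB by auto
  then obtain u where u: "u \<in> {0..<m}" "coprime u m" "\<And>x. x \<in> {0..<m} \<Longrightarrow> p x = u * x mod m"
    using reflect_iso_mult[OF m _ _ p i] by blast
  have "B = (\<lambda>x. u * x mod m) ` A"
  proof (rule reflect_iso_image[OF m AB u(2)])
    fix i j assume "i \<in> {0..<m}" "j \<in> {0..<m}"
    then show "u * reflect_op m A i j mod m = reflect_op m B (u * i mod m) (u * j mod m)"
      using p(2)[of i j] reflect_op_in_range[of m A i j] m by (simp add: u(3))
  qed
  moreover have "u \<in> Units R"
    using u(1,2) m by (cases "u = 0") (auto simp: res_units_eq)
  ultimately show ?thesis
    using AB by (auto simp: mem_subset_orbit_iff)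
qed

text \<open>Two neighbours of the same kind in either set force a multiplication by a unit;
  otherwise the sets coincide. Conversely, multiplication by a unit permutes the residues and
  respects both sums and differences.\<close>

lemma reflect_iso_iff_orbit:
  assumes m: "m > 2" and AB: "A \<subseteq> {1..<m}" "B \<subseteq> {1..<m}"
  shows "reflect_iso m A B \<longleftrightarrow> B \<in> subset_orbit A"
proof
  assume iso: "reflect_iso m A B"
  interpret A: group_action "units_of R" "{1..<m}" "mult_action m"
    by (rule group_action_mult)
  interpret P: group_action "units_of R" "Pow {1..<m}" "on_subsets {1..<m} (mult_action m)"
    by (rule A.group_action_on_subsets)
  have iso': "reflect_iso m B A"
    using reflect_iso_sym[OF _ iso] m by simp
  show "B \<in> subset_orbit A"
  proof (cases "(\<exists>i\<in>{0..<m}. i \<in> A \<longleftrightarrow> (i + 1) mod m \<in> A) \<or> (\<exists>i\<in>{0..<m}. i \<in> B \<longleftrightarrow> (i + 1) mod m \<in> B)")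
    case True
    then show ?thesis
    proof
      assume "\<exists>i\<in>{0..<m}. i \<in> A \<longleftrightarrow> (i + 1) mod m \<in> A"
      then show ?thesis
        using reflect_iso_imp_orbit_aux[OF m AB iso] by (elim bexE)
    next
      assume "\<exists>i\<in>{0..<m}. i \<in> B \<longleftrightarrow> (i + 1) mod m \<in> B"
      then have "A \<in> subset_orbit B"
        using reflect_iso_imp_orbit_aux[OF m AB(2,1) iso'] by (elim bexE)
      with AB show ?thesis
        using P.orbit_sym[of B A] by blast
    qed
  next
    \<comment> \<open>Membership alternates in both sets, so both consist of the odd residues.\<close>
    case False
    have nat: "int k < m \<Longrightarrow> int k \<in> A \<longleftrightarrow> int k \<in> B" for k
    proof (induction k)
      case (Suc k)
      then have "(int k + 1) mod m = int (Suc k)" "int k \<in> {0..<m}"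
        by simp_all
      then show ?case
        using False Suc.IH by auto
    qed (use AB in auto)
    have "x \<in> A \<longleftrightarrow> x \<in> B" if "x \<in> {1..<m}" for x
      using that nat[of "nat x"] by simp
    with AB have "A = B" by blast
    then show ?thesis
      using AB P.orbit_refl[of A] by simp
  qed
next
  assume "B \<in> subset_orbit A"
  then obtain u where u: "u \<in> Units R" and B: "B = (\<lambda>x. u * x mod m) ` A"
    using AB by (auto simp: mem_subset_orbit_iff)
  have cop: "coprime u m"
    using u by (simp add: res_units_eq)
  let ?p = "\<lambda>x. u * x mod m"
  have inj: "inj_on ?p {0..<m}"
    by (rule inj_onI) (simp add: coprime_mult_eq_iff[OF cop])
  have "?p ` {0..<m} \<subseteq> {0..<m}"
    using m by auto
  then have "?p ` {0..<m} = {0..<m}"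
    by (rule endo_inj_surj[OF finite_atLeastLessThan_int _ inj])
  with inj have "bij_betw ?p {0..<m} {0..<m}"
    by (simp add: bij_betw_def)
  moreover have "?p (reflect_op m A i j) = reflect_op m B (?p i) (?p j)"
    if "i \<in> {0..<m}" "j \<in> {0..<m}" for i j
  proof -
    have "A \<subseteq> {0..<m}"
      using AB by auto
    then have mem: "?p i \<in> B \<longleftrightarrow> i \<in> A"
      unfolding B by (rule inj_on_image_mem_iff[OF inj that(1)])
    have add: "?p ((i + j) mod m) = (?p i + ?p j) mod m"
      by (simp only: mod_mult_right_eq mod_add_eq distrib_left)
    have diff: "?p ((i - j) mod m) = (?p i - ?p j) mod m"
      by (simp only: mod_mult_right_eq mod_diff_eq right_diff_distrib)
    show ?thesis
      unfolding reflect_op_def mem if_distrib[of "\<lambda>x. x mod m"] if_distrib[of ?p] add diff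
      by (rule refl)
  qed
  ultimately show "reflect_iso m A B"
    unfolding reflect_iso_def by blast
qed

end


section \<open>Left transversals of a reflection subgroup\<close>

lemma carrier_dihedral: "carrier (dihedral n) = {0..<int n} \<times> UNIV"
  by (simp add: dihedral_def)

lemma mult_dihedral:
  "(i, s) \<otimes>\<^bsub>dihedral n\<^esub> (j, t) = ((if s then i - j else i + j) mod int n, s \<noteq> t)"
  by (simp add: dihedral_def)

lemma one_dihedral: "\<one>\<^bsub>dihedral n\<^esub> = (0, False)"
  by (simp add: dihedral_def)

lemma inv_dihedral:
  assumes "n > 0" "i \<in> {0..<int n}"
  shows "inv\<^bsub>dihedral n\<^esub> (i, s) = (if s then i else (- i) mod int n, s)"
proof -
  interpret group "dihedral n"
    using assms by (intro group_dihedral) simp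
  show ?thesis
    by (rule inv_equality)
      (use assms in \<open>auto simp: carrier_dihedral mult_dihedral one_dihedral mod_simps\<close>)
qed

text \<open>Conjugation by a rotation fixes every rotation, and conjugation by a reflection inverts
  it.\<close>

lemma generate_rotation_normal:
  assumes "n > 0" "i \<in> {0..<int n}"
  shows "generate (dihedral n) {(i, False)} \<lhd> dihedral n"
proof -
  interpret group "dihedral n"
    using assms by (intro group_dihedral) simp
  let ?H = "generate (dihedral n) {(i, False)}"
  have sub: "subgroup ?H (dihedral n)"
    using assms by (intro generate_is_subgroup) (simp add: carrier_dihedral)
  have rot: "\<not> snd h" if "h \<in> ?H" for h
    using that by induction (use assms in \<open>auto simp: one_dihedral inv_dihedral mult_dihedral\<close>)
  have "x \<otimes>\<^bsub>dihedral n\<^esub> h \<otimes>\<^bsub>dihedral n\<^esub> inv\<^bsub>dihedral n\<^esub> x \<in> ?H"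
    if x: "x \<in> carrier (dihedral n)" and h: "h \<in> ?H" for x h
  proof -
    obtain a s where x': "x = (a, s)" "a \<in> {0..<int n}"
      using x by (auto simp: carrier_dihedral)
    have "h \<in> carrier (dihedral n)"
      using h subgroup.mem_carrier[OF sub] by simp
    then obtain k where k: "h = (k, False)" "k \<in> {0..<int n}"
      using rot[OF h] by (cases h) (auto simp: carrier_dihedral)
    have "x \<otimes>\<^bsub>dihedral n\<^esub> h \<otimes>\<^bsub>dihedral n\<^esub> inv\<^bsub>dihedral n\<^esub> x =
        (if s then inv\<^bsub>dihedral n\<^esub> h else h)"
      using x' k assms by (simp add: inv_dihedral mult_dihedral mod_simps)
    then show ?thesis
      using h subgroup.m_inv_closed[OF sub h] by simp
  qed
  with sub show ?thesis
    by (simp add: normal_inv_iff)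
qed

text \<open>Modulo 1 or 2 every residue equals its negative, so the sign in the multiplication
  disappears.\<close>

lemma comm_group_dihedral:
  assumes "0 < n" "n \<le> 2"
  shows "comm_group (dihedral n)"
proof -
  interpret group "dihedral n"
    using assms by (intro group_dihedral) simp
  show ?thesis
  proof (rule group_comm_groupI)
    fix x y assume xy: "x \<in> carrier (dihedral n)" "y \<in> carrier (dihedral n)"
    obtain i s j t where [simp]: "x = (i, s)" "y = (j, t)"
      by (cases x; cases y)
    have "n = 1 \<or> n = 2"
      using assms by auto
    then have "int n dvd 2"
      by auto
    then have "int n dvd (i + j) - (i - j)" "int n dvd (i + j) - (j - i)" "int n dvd (i - j) - (j - i)"
      by (auto simp: algebra_simps simp flip: mult_2 right_diff_distrib)
    then have "(i + j) mod int n = (i - j) mod int n" "(i + j) mod int n = (j - i) mod int n"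
      by (simp_all only: mod_eq_dvd_iff)
    then show "x \<otimes>\<^bsub>dihedral n\<^esub> y = y \<otimes>\<^bsub>dihedral n\<^esub> x"
      by (auto simp: mult_dihedral add.commute)
  qed
qed

text \<open>A rotation generates a normal subgroup, and for \<open>n \<le> 2\<close> every subgroup
  is normal by commutativity; only reflections with \<open>n > 2\<close> remain.\<close>

lemma nonnormal_generateE:
  assumes "n > 0" "b \<in> carrier (dihedral n)" "\<not> generate (dihedral n) {b} \<lhd> dihedral n"
  obtains c where "n > 2" "c \<in> {0..<int n}" "b = (c, True)"
proof -
  obtain c s where b: "b = (c, s)" "c \<in> {0..<int n}"
    using assms(2) by (auto simp: carrier_dihedral)
  have s
    using assms b generate_rotation_normal by (cases s) auto
  moreover have "n > 2"
  proof (rule ccontr)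
    assume "\<not> ?thesis"
    then interpret comm_group "dihedral n"
      using assms(1) by (intro comm_group_dihedral) auto
    have "subgroup (generate (dihedral n) {b}) (dihedral n)"
      using assms(2) by (intro generate_is_subgroup) simp
    then show False
      using assms(3) by (simp add: normal_iff_subgroup)
  qed
  ultimately show ?thesis
    using b that by simp
qed

section \<open>Cosets and their representatives for an arbitrary reflection\<close>

locale dihedral_reflection =
  fixes n :: nat and c :: int
  assumes n: "n > 2" and c: "c \<in> {0..<int n}"
begin

sublocale group "dihedral n"
  using n by (intro group_dihedral) simp

abbreviation "D \<equiv> dihedral n"
abbreviation "I \<equiv> {0..<int n}"
abbreviation "H \<equiv> {(0, False), (c, True)}"

lemma generate_reflection: "generate D {(c, True)} = H"
proof
  show "generate D {(c, True)} \<subseteq> H"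
  proof
    fix x assume "x \<in> generate D {(c, True)}"
    then show "x \<in> H"
      by induction (use n c in \<open>auto simp: one_dihedral inv_dihedral mult_dihedral\<close>)
  qed
  show "H \<subseteq> generate D {(c, True)}"
    using generate.one[of D] by (auto simp: one_dihedral intro: generate.incl)
qed

text \<open>The left coset of \<open>(i, False)\<close>: its reflection is the product of
  \<open>(i, False)\<close> and \<open>(c, True)\<close>, whence the shift by \<open>c\<close>,
  which \<open>index\<close> undoes.\<close>

definition coset :: "int \<Rightarrow> (int \<times> bool) set" where
  "coset i = {(i, False), ((i + c) mod int n, True)}"

definition index :: "int \<times> bool \<Rightarrow> int" where
  "index x = (if snd x then (fst x - c) mod int n else fst x)"

definition rep :: "int set \<Rightarrow> int \<Rightarrow> int \<times> bool" where
  "rep B i = (if i \<in> B then ((i + c) mod int n, True) else (i, False))"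

definition transversal :: "int set \<Rightarrow> (int \<times> bool) set" where
  "transversal B = rep B ` I"

lemma index_in_range: "x \<in> carrier D \<Longrightarrow> index x \<in> I"
  using n by (auto simp: index_def carrier_dihedral)

lemma mem_coset_iff: "x \<in> carrier D \<Longrightarrow> i \<in> I \<Longrightarrow> x \<in> coset i \<longleftrightarrow> index x = i"
  by (cases x) (auto simp: coset_def index_def carrier_dihedral mod_simps)

lemma l_coset_eq:
  assumes "x \<in> carrier D"
  shows "x <#\<^bsub>D\<^esub> H = coset (index x)"
  using assms by (cases x) (auto simp: l_coset_def coset_def index_def mult_dihedral carrier_dihedral mod_simps)

lemma lcosets_eq: "lcosets\<^bsub>D\<^esub> H = coset ` I"
proof -
  have "i \<in> index ` carrier D" if "i \<in> I" for i
    by (rule image_eqI[of _ _ "(i, False)"]) (use that in \<open>simp_all add: index_def carrier_dihedral\<close>)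
  then have "index ` carrier D = I"
    using index_in_range by blast
  moreover have "lcosets\<^bsub>D\<^esub> H = coset ` index ` carrier D"
    by (auto simp: LCOSETS_def l_coset_eq)
  ultimately show ?thesis by simp
qed

lemma rep_in_carrier: "i \<in> I \<Longrightarrow> rep B i \<in> carrier D"
  using n by (auto simp: rep_def carrier_dihedral)

lemma rep_in_transversal: "i \<in> I \<Longrightarrow> rep B i \<in> transversal B"
  unfolding transversal_def by (rule imageI)

lemma index_rep: "i \<in> I \<Longrightarrow> index (rep B i) = i"
  by (auto simp: rep_def index_def mod_simps)

lemma inj_on_rep: "inj_on (rep B) I"
  by (metis index_rep inj_onI)

lemma transversal_inter_coset:
  assumes "i \<in> I"
  shows "transversal B \<inter> coset i = {rep B i}"
proof -
  have "rep B j \<in> coset i \<longleftrightarrow> j = i" if "j \<in> I" for j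
    using mem_coset_iff[OF rep_in_carrier[OF that] assms] index_rep[OF that] by simp
  then show ?thesis
    using assms by (auto simp: transversal_def)
qed

lemma transversal_in:
  assumes "B \<subseteq> {1..<int n}"
  shows "transversal B \<in> left_transversals D H"
proof -
  have "rep B 0 = (0, False)"
    using assms by (auto simp: rep_def)
  then have "(0, False) \<in> transversal B"
    using n by (auto simp: transversal_def intro: rev_image_eqI[of 0])
  moreover have "transversal B \<subseteq> carrier D"
    using rep_in_carrier by (auto simp: transversal_def)
  moreover have "\<exists>!x. x \<in> transversal B \<inter> C" if "C \<in> lcosets\<^bsub>D\<^esub> H" for C
  proof -
    from that obtain i where "i \<in> I" "C = coset i"
      unfolding lcosets_eq by blast
    then show ?thesis
      by (simp add: transversal_inter_coset)
  qed
  ultimately show ?thesis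
    by (simp add: left_transversals_def one_dihedral)
qed

lemma inj_on_transversal: "inj_on transversal (Pow {1..<int n})"
proof (rule inj_onI)
  fix A B assume AB: "A \<in> Pow {1..<int n}" "B \<in> Pow {1..<int n}" and eq: "transversal A = transversal B"
  have "i \<in> A \<longleftrightarrow> i \<in> B" if "i \<in> I" for i
  proof -
    have "{rep A i} = {rep B i}"
      using transversal_inter_coset[OF that] eq by metis
    then show ?thesis
      by (auto simp: rep_def split: if_splits)
  qed
  moreover have "A \<subseteq> I" "B \<subseteq> I"
    using AB by auto
  ultimately show "A = B"
    by blast
qed

text \<open>Each coset has one rotation and one reflection, so \<open>S\<close> is determined by the
  set \<open>B\<close> of cosets that contribute their reflection. The coset \<open>H\<close>
  contributes the identity, whence 0 is not in \<open>B\<close>.\<close>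

lemma left_transversal_is_transversal:
  assumes "S \<in> left_transversals D H"
  shows "\<exists>B\<subseteq>{1..<int n}. S = transversal B"
proof -
  have S: "S \<subseteq> carrier D" "(0, False) \<in> S"
    and ex1: "\<And>i. i \<in> I \<Longrightarrow> \<exists>!x. x \<in> S \<inter> coset i"
    using assms by (auto simp: left_transversals_def lcosets_eq one_dihedral)
  define B where "B = {i \<in> I. ((i + c) mod int n, True) \<in> S}"
  have rep: "S \<inter> coset i = {rep B i}" if i: "i \<in> I" for i
  proof -
    obtain x where "S \<inter> coset i = {x}"
      using ex1[OF i] by blast
    then show ?thesis
      using i by (auto simp: coset_def rep_def B_def)
  qed
  have "0 \<notin> B"
    using rep[of 0] S n by (auto simp: coset_def rep_def)
  have "S = transversal B"
  proof
    show "S \<subseteq> transversal B"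
    proof
      fix x assume x: "x \<in> S"
      then have xc: "x \<in> carrier D"
        using S by blast
      have "index x \<in> I"
        by (rule index_in_range[OF xc])
      moreover from this have "x \<in> coset (index x)"
        by (simp only: mem_coset_iff[OF xc])
      ultimately have "x = rep B (index x)"
        using rep[of "index x"] x by blast
      then show "x \<in> transversal B"
        using \<open>index x \<in> I\<close> unfolding transversal_def by blast
    qed
    show "transversal B \<subseteq> S"
      unfolding transversal_def using rep by blast
  qed
  have "B \<subseteq> I"
    by (auto simp: B_def)
  then have "i \<in> {1..<int n}" if "i \<in> B" for i
    using that \<open>0 \<notin> B\<close> by (cases "i = 0") auto
  then have "B \<subseteq> {1..<int n}" ..
  with \<open>S = transversal B\<close> show ?thesis by blast
qed

lemma left_transversals_eq: "left_transversals D H = transversal ` Pow {1..<int n}"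
  using transversal_in left_transversal_is_transversal by blast

text \<open>The shift by \<open>c\<close> cancels from the labels: a reflection as left factor
  reverses the sign of \<open>j\<close>, a rotation keeps it, and the kind of the right factor does
  not affect the coset of the product.\<close>

lemma transversal_struct_mult:
  assumes "i \<in> I" "j \<in> I"
  shows "rep B i \<otimes>\<^bsub>transversal_struct D H (transversal B)\<^esub> rep B j = rep B (reflect_op (int n) B i j)"
proof -
  have "index (rep B i \<otimes>\<^bsub>D\<^esub> rep B j) = reflect_op (int n) B i j"
    by (simp add: rep_def mult_dihedral index_def reflect_op_def mod_simps)
  then have "(rep B i \<otimes>\<^bsub>D\<^esub> rep B j) <#\<^bsub>D\<^esub> H = coset (reflect_op (int n) B i j)"
    using assms by (simp add: l_coset_eq rep_in_carrier)
  then show ?thesis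
    using transversal_inter_coset[OF reflect_op_in_range] n by (simp add: transversal_struct_def)
qed

lemma bij_betw_rep: "bij_betw (rep B) I (transversal B)"
  by (simp add: bij_betw_def inj_on_rep transversal_def)

lemma bij_betw_index: "bij_betw index (transversal B) I"
  by (rule bij_betw_byWitness[where f' = "rep B"]) (auto simp: transversal_def index_rep simp del: atLeastLessThan_iff)

text \<open>The labelling \<open>rep\<close> is a bijection from the residues to the transversal
  with inverse \<open>index\<close>, so isomorphisms are transported by composing with these
  maps.\<close>

lemma transversal_struct_iso_iff:
  "transversal_struct D H (transversal A) \<cong> transversal_struct D H (transversal B) \<longleftrightarrow>
    reflect_iso (int n) A B"
proof -
  let ?S = "\<lambda>B. transversal_struct D H (transversal B)"
  have carr: "carrier (?S B) = transversal B" for B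
    by (simp add: transversal_struct_def)
  have in_range: "reflect_op (int n) B i j \<in> I" for B i j
    using n by (intro reflect_op_in_range) simp
  show ?thesis
  proof
    assume "?S A \<cong> ?S B"
    then obtain h where hom: "h \<in> hom (?S A) (?S B)" and bij: "bij_betw h (transversal A) (transversal B)"
      by (auto simp: is_iso_def iso_def carr)
    define p where "p = index \<circ> (h \<circ> rep A)"
    have p: "bij_betw p I I"
      unfolding p_def by (rule bij_betw_trans[OF bij_betw_trans[OF bij_betw_rep bij] bij_betw_index])
    have rep_p: "rep B (p i) = h (rep A i)" if "i \<in> I" for i
    proof -
      have "h (rep A i) \<in> transversal B"
        by (rule bij_betw_apply[OF bij rep_in_transversal[OF that]])
      then show ?thesis
        by (auto simp: p_def transversal_def index_rep)
    qed
    have "p (reflect_op (int n) A i j) = reflect_op (int n) B (p i) (p j)" if ij: "i \<in> I" "j \<in> I" for i j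
    proof -
      have p_ij: "p i \<in> I" "p j \<in> I"
        using ij by (simp_all only: bij_betw_apply[OF p])
      have "rep B (p (reflect_op (int n) A i j)) = h (rep A i \<otimes>\<^bsub>?S A\<^esub> rep A j)"
        by (simp only: rep_p[OF in_range] transversal_struct_mult[OF ij])
      also have "\<dots> = h (rep A i) \<otimes>\<^bsub>?S B\<^esub> h (rep A j)"
        by (rule hom_mult[OF hom]) (simp_all only: carr rep_in_transversal ij)
      also have "\<dots> = rep B (reflect_op (int n) B (p i) (p j))"
        by (simp only: transversal_struct_mult[OF p_ij] flip: rep_p[OF ij(1)] rep_p[OF ij(2)])
      finally show ?thesis
        by (rule inj_onD[OF inj_on_rep _ bij_betw_apply[OF p in_range] in_range])
    qed
    with p show "reflect_iso (int n) A B"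
      unfolding reflect_iso_def by blast
  next
    assume "reflect_iso (int n) A B"
    then obtain p where p: "bij_betw p I I"
      "\<And>i j. i \<in> I \<Longrightarrow> j \<in> I \<Longrightarrow> p (reflect_op (int n) A i j) = reflect_op (int n) B (p i) (p j)"
      unfolding reflect_iso_def by blast
    define h where "h = rep B \<circ> (p \<circ> index)"
    have bij: "bij_betw h (transversal A) (transversal B)"
      unfolding h_def by (rule bij_betw_trans[OF bij_betw_trans[OF bij_betw_index p(1)] bij_betw_rep])
    have h_rep: "h (rep A i) = rep B (p i)" if "i \<in> I" for i
      using that by (simp add: h_def index_rep)
    have "h \<in> hom (?S A) (?S B)"
    proof (rule homI)
      fix x y assume "x \<in> carrier (?S A)" "y \<in> carrier (?S A)"
      then obtain i j where ij: "i \<in> I" "j \<in> I" and xy: "x = rep A i" "y = rep A j"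
        unfolding carr unfolding transversal_def by blast
      have p_ij: "p i \<in> I" "p j \<in> I"
        using ij by (simp_all only: bij_betw_apply[OF p(1)])
      show "h (x \<otimes>\<^bsub>?S A\<^esub> y) = h x \<otimes>\<^bsub>?S B\<^esub> h y"
        by (simp only: xy transversal_struct_mult[OF ij] h_rep[OF in_range] h_rep[OF ij(1)] h_rep[OF ij(2)]
            transversal_struct_mult[OF p_ij] p(2)[OF ij])
    qed (use bij in \<open>auto simp: carr dest: bij_betwE\<close>)
    with bij show "?S A \<cong> ?S B"
      by (auto simp: is_iso_def iso_def carr)
  qed
qed

text \<open>The injective map \<open>transversal\<close> identifies the sets of nonzero residues
  with the left transversals, and orbits with isomorphism classes.\<close>

lemma ict_eq_card_orbits:
  "ict D H = card (orbits (units_of (residue_ring (int n))) (Pow {1..<int n})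
      (on_subsets {1..<int n} (mult_action (int n))))"
proof -
  let ?R = "residue_ring (int n)"
  interpret residues "int n" ?R
    using n by unfold_locales auto
  interpret A: group_action "units_of ?R" "{1..<int n}" "mult_action (int n)"
    by (rule group_action_mult)
  interpret P: group_action "units_of ?R" "Pow {1..<int n}" "on_subsets {1..<int n} (mult_action (int n))"
    by (rule A.group_action_on_subsets)
  let ?O = "orbits (units_of ?R) (Pow {1..<int n}) (on_subsets {1..<int n} (mult_action (int n)))"
  have orbit_sub: "subset_orbit A \<subseteq> Pow {1..<int n}" if "A \<in> Pow {1..<int n}" for A
    using P.orbits_coverture that by (auto simp: orbits_def)
  have iso_iff: "(transversal A, transversal B) \<in> transversal_iso D H \<longleftrightarrow> B \<in> subset_orbit A"
    if "A \<in> Pow {1..<int n}" "B \<in> Pow {1..<int n}" for A B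
    using that n transversal_in by (simp add: transversal_iso_def transversal_struct_iso_iff reflect_iso_iff_orbit)
  have iso_class: "transversal_iso D H `` {transversal A} = transversal ` subset_orbit A"
    if A: "A \<in> Pow {1..<int n}" for A
  proof (intro equalityI subsetI)
    fix T assume T: "T \<in> transversal_iso D H `` {transversal A}"
    then have "T \<in> left_transversals D H"
      by (auto simp: transversal_iso_def)
    then obtain B where "B \<in> Pow {1..<int n}" "T = transversal B"
      by (auto simp: left_transversals_eq)
    then show "T \<in> transversal ` subset_orbit A"
      using T iso_iff[OF A] by auto
  next
    fix T assume "T \<in> transversal ` subset_orbit A"
    then show "T \<in> transversal_iso D H `` {transversal A}"
      using iso_iff[OF A] orbit_sub[OF A] by blast
  qed
  have "left_transversals D H // transversal_iso D H = (`) transversal ` ?O"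
    unfolding quotient_def left_transversals_eq orbits_def using iso_class by auto
  moreover have "inj_on ((`) transversal) ?O"
  proof (rule inj_on_subset[OF inj_on_image_Pow[OF inj_on_transversal]])
    show "?O \<subseteq> Pow (Pow {1..<int n})"
      using P.orbits_coverture by blast
  qed
  ultimately show ?thesis
    by (simp add: ict_def card_image)
qed

end

theorem lemma5p6:
  fixes n :: nat and b :: "int \<times> bool"
  assumes "n \<ge> 1"
    and "b \<in> carrier (dihedral n)"
    and "card (generate (dihedral n) {b}) = 2"
    and "\<not> (generate (dihedral n) {b} \<lhd> dihedral n)"
  shows "real (ict (dihedral n) (generate (dihedral n) {b})) =
    (1 / real (totient n)) *
      (\<Sum>j | 1 \<le> j \<and> j \<le> n \<and> coprime j n. 2 powr (tt n j + real (kk n j) - 1))"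
proof -
  obtain c where c: "n > 2" "c \<in> {0..<int n}" and b: "b = (c, True)"
    using nonnormal_generateE[of n b] assms(1,2,4) by auto
  interpret dihedral_reflection n c
    using c by unfold_locales
  have "n > 1"
    using n by simp
  then show ?thesis
    unfolding b generate_reflection ict_eq_card_orbits by (rule card_orbits_subsets_mult_action)
qed

end
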